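(* Let $(\mathcal{A},\mathcal{Q})$ be a signed reconstruction of $\mathcal{P}$, with signs $\sigma_1,\ldots,\sigma_m$. There is an $H\in\mathrm{GL}_4(\mathbb{R})$ such that $(\mathcal{A}H^{-1},H\mathcal{Q})$ is a chiral reconstruction of $\mathcal{P}$ if and only if $$K_\mathcal{Q}^\ast\cap\left(\operatorname{int}K_{\sigma C}^\ast\cup\operatorname{int}K_{-\sigma C}^\ast\right)$$ contains a nonzero vector, where $\operatorname{int}K_{\sigma C}^\ast$ and $\operatorname{int}K_{-\sigma C}^\ast$ are the (relative) interiors of the dual cones of $K_{\sigma C}$ and $K_{-\sigma C}$, and $K_\mathcal{Q}^\ast$ is the dual cone of $K_\mathcal{Q}$.
   Context: $\mathbb{P}^3=(\mathbb{R}^4\setminus\{0\})/\!\sim$ is real projective space with the quotient topology. A point is finite if its fourth coordinate is nonzero; $\mathbf{n}_\infty=(0,0,0,1)^\top$. A camera is a rank-3 matrix $A=[\,G\ \ \mathbf{t}\,]\in\mathbb{R}^{3\times4}$, finite if $\det G\ne0$. The center of a finite camera is represented by $\mathbf{c}_A=(-G^{-1}\mathbf{t};\,1)\in\mathbb{R}^4$ and its principal ray is $\mathbf{n}_A=\det(G)A_{3,\bullet}^\top\in\mathbb{R}^4$ ($A_{3,\bullet}$ the third row). Write $\mathbf{c}_i=\mathbf{c}_{A_i}$, $\mathbf{n}_i=\mathbf{n}_{A_i}$. Cameras in an arrangement have pairwise distinct centers. For finite $\mathbf{q}$, $\operatorname{depth}(\mathbf{q};A)=\frac{1}{|\det G|\,\|G_{3,\bullet}\|}\cdot\frac{\mathbf{n}_A^\top\mathbf{q}}{\mathbf{n}_\infty^\top\mathbf{q}}$.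 The chiral domain $D_\mathcal{A}\subseteq\mathbb{P}^3$ is the closure of the set of finite points having positive depth in every camera of $\mathcal{A}$. Let $\mathcal{P}=\{(\mathbf{p}_{1k},\ldots,\mathbf{p}_{mk})\in(\mathbb{R}^2)^m: k=1,\ldots,n\}$; write $\widehat{\mathbf{p}}=(\mathbf{p},1)$. A projective reconstruction of $\mathcal{P}$ is a pair $(\mathcal{A},\mathcal{Q})$ of an arrangement $\mathcal{A}=\{A_1,\ldots,A_m\}$ of finite cameras and points $\mathcal{Q}=\{\mathbf{q}_1,\ldots,\mathbf{q}_n\}\subseteq\mathbb{R}^4\setminus\{0\}$ with $A_i\mathbf{q}_k=w_{ik}\widehat{\mathbf{p}}_{ik}$ for some nonzero scalars $w_{ik}$. It is chiral if $\mathbf{q}_k\in D_\mathcal{A}$ for all $k$. It is signed if for each $i$ there is $\sigma_i\in\{-1,1\}$ with $\operatorname{sign}(\mathbf{n}_i^\top\mathbf{q}_k)=\sigma_i$ for all $k$. $\mathcal{A}H^{-1}=\{A_iH^{-1}\}_i$, $H\mathcal{Q}=\{H\mathbf{q}_k\}_k$. For a finite $U\subset\mathbb{R}^4$, $K_U$ is the set of nonnegative linear combinations of $U$ and $K_U^\ast=\{\mathbf{y}\in\mathbb{R}^4:\mathbf{y}^\top\mathbf{x}\ge0\ \forall\mathbf{x}\in K_U\}$. For a cone $K$, $\operatorname{int}K$ denotes its relative interior, i.e. its interior in the linear span of $K$. Here $\sigma C=\{\sigma_1\mathbf{c}_1,\ldots,\sigma_m\mathbf{c}_m\}$ and $-\sigma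 C=\{-\sigma_1\mathbf{c}_1,\ldots,-\sigma_m\mathbf{c}_m\}$.
   Formalization: The interiors of the dual cones of K_{σC} and K_{-σC} are taken as topological interiors in R^4, not relative interiors; with relative interiors the equivalence fails, e.g. for three collinear centers c_1, c_2=(c_1+c_3)/2, c_3 with signs +,-,+. *)

theory Defs
  imports "HOL-Analysis.Analysis"
begin

section \<open>Real projective 3-space\<close>

definition proj_rel :: "real^4 \<Rightarrow> real^4 \<Rightarrow> bool" where
  "proj_rel x y \<longleftrightarrow> x \<noteq> 0 \<and> y \<noteq> 0 \<and> (\<exists>c. c \<noteq> 0 \<and> x = c *\<^sub>R y)"

quotient_type proj3 = "real^4" / partial: proj_rel
proof (rule part_equivpI)
  show "\<exists>x. proj_rel x x"
    by (rule exI[of _ "axis 4 1"]) (auto simp: proj_rel_def axis_eq_0_iff intro: exI[of _ 1])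
  show "symp proj_rel"
  proof (rule sympI)
    fix x y assume "proj_rel x y"
    then obtain c where "x \<noteq> 0" "y \<noteq> 0" "c \<noteq> 0" "x = c *\<^sub>R y"
      by (auto simp: proj_rel_def)
    then show "proj_rel y x"
      unfolding proj_rel_def by (auto intro!: exI[of _ "inverse c"])
  qed
  show "transp proj_rel"
  proof (rule transpI)
    fix x y z assume "proj_rel x y" "proj_rel y z"
    then obtain c d where "x \<noteq> 0" "z \<noteq> 0" "c \<noteq> 0" "x = c *\<^sub>R y" "d \<noteq> 0" "y = d *\<^sub>R z"
      by (auto simp: proj_rel_def)
    then show "proj_rel x z"
      unfolding proj_rel_def by (auto intro!: exI[of _ "c * d"])
  qed
qed

text \<open>The class of a nonzero vector; the value at \<open>0\<close> is junk and is never used below.\<close>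

definition proj :: "real^4 \<Rightarrow> proj3" where
  "proj x = abs_proj3 x"

lemma proj_eq_iff:
  assumes "x \<noteq> 0" "y \<noteq> 0"
  shows "proj x = proj y \<longleftrightarrow> (\<exists>c. c \<noteq> 0 \<and> x = c *\<^sub>R y)"
proof -
  have refl: "proj_rel z z" if "z \<noteq> 0" for z
    using that by (auto simp: proj_rel_def intro: exI[of _ 1])
  show ?thesis
    using Quotient_rel[OF Quotient_proj3, of x y] refl[OF assms(1)] refl[OF assms(2)] assms
    by (simp add: proj_def proj_rel_def)
qed

text \<open>The quotient topology induced by \<^const>\<open>proj\<close> on the nonzero vectors.\<close>

instantiation proj3 :: topological_space
begin

definition open_proj3 :: "proj3 set \<Rightarrow> bool" where
  "open_proj3 U \<longleftrightarrow> openin (top_of_set (- {0})) {x \<in> - {0}. proj x \<in> U}"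

instance
proof
  show "open (UNIV :: proj3 set)"
    using openin_topspace[of "top_of_set (- {0 :: real^4})"]
    by (simp add: open_proj3_def Compl_eq)
  show "open (S \<inter> T)" if "open S" "open T" for S T :: "proj3 set"
  proof -
    have "{x \<in> - {0}. proj x \<in> S \<inter> T} = {x \<in> - {0}. proj x \<in> S} \<inter> {x \<in> - {0}. proj x \<in> T}"
      by auto
    then show ?thesis
      using openin_Int that by (simp only: open_proj3_def)
  qed
  show "open (\<Union> K)" if "\<forall>S\<in>K. open S" for K :: "proj3 set set"
  proof -
    have "{x \<in> - {0}. proj x \<in> \<Union> K} = (\<Union>S\<in>K. {x \<in> - {0}. proj x \<in> S})"
      by auto
    moreover have "openin (top_of_set (- {0})) (\<Union>S\<in>K. {x \<in> - {0}. proj x \<in> S})"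
      using that by (intro openin_Union) (auto simp only: open_proj3_def)
    ultimately show ?thesis by (simp only: open_proj3_def)
  qed
qed

end

section \<open>Cameras\<close>

definition left_block :: "real^4^3 \<Rightarrow> real^3^3" where
  "left_block A = (\<chi> i. vector [A $ i $ 1, A $ i $ 2, A $ i $ 3])"

definition camera :: "real^4^3 \<Rightarrow> bool" where
  "camera A \<longleftrightarrow> rank A = 3"

definition finite_camera :: "real^4^3 \<Rightarrow> bool" where
  "finite_camera A \<longleftrightarrow> camera A \<and> det (left_block A) \<noteq> 0"

definition homog2 :: "real^2 \<Rightarrow> real^3" where
  "homog2 p = vector [p $ 1, p $ 2, 1]"

definition homog3 :: "real^3 \<Rightarrow> real^4" where
  "homog3 v = vector [v $ 1, v $ 2, v $ 3, 1]"

text \<open>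
  \<open>A = [G t]\<close> with \<open>G = left_block A\<close> and \<open>t = column 4 A\<close>.  The center, the principal ray and the
  depth are only meaningful for finite cameras, and all uses below are guarded accordingly.
\<close>

definition center :: "real^4^3 \<Rightarrow> real^4" where
  "center A = homog3 (- (matrix_inv (left_block A) *v column 4 A))"

definition principal_ray :: "real^4^3 \<Rightarrow> real^4" where
  "principal_ray A = det (left_block A) *\<^sub>R row 3 A"

definition n_inf :: "real^4" where
  "n_inf = axis 4 1"

definition depth :: "real^4 \<Rightarrow> real^4^3 \<Rightarrow> real" where
  "depth q A = 1 / (\<bar>det (left_block A)\<bar> * norm (row 3 (left_block A)))
                 * ((principal_ray A \<bullet> q) / (n_inf \<bullet> q))"

text \<open>
  Arrangements are families over a finite (hence nonempty) index type.  Centers have last coordinate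
  \<open>1\<close>, so that they are distinct as points of projective space iff they are distinct as vectors.
\<close>

definition finite_arrangement :: "('m::finite \<Rightarrow> real^4^3) \<Rightarrow> bool" where
  "finite_arrangement A \<longleftrightarrow> (\<forall>i. finite_camera (A i)) \<and> inj (\<lambda>i. center (A i))"

definition chiral_domain :: "('m::finite \<Rightarrow> real^4^3) \<Rightarrow> proj3 set" where
  "chiral_domain A = closure (proj ` {q. q \<noteq> 0 \<and> q $ 4 \<noteq> 0 \<and> (\<forall>i. depth q (A i) > 0)})"

section \<open>Reconstructions\<close>

definition projective_reconstruction ::
  "('m::finite \<Rightarrow> 'n::finite \<Rightarrow> real^2) \<Rightarrow> ('m \<Rightarrow> real^4^3) \<Rightarrow> ('n \<Rightarrow> real^4) \<Rightarrow> bool" where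
  "projective_reconstruction P A Q \<longleftrightarrow>
     finite_arrangement A \<and> (\<forall>k. Q k \<noteq> 0) \<and>
     (\<forall>i k. \<exists>w. w \<noteq> 0 \<and> A i *v Q k = w *\<^sub>R homog2 (P i k))"

definition chiral_reconstruction ::
  "('m::finite \<Rightarrow> 'n::finite \<Rightarrow> real^2) \<Rightarrow> ('m \<Rightarrow> real^4^3) \<Rightarrow> ('n \<Rightarrow> real^4) \<Rightarrow> bool" where
  "chiral_reconstruction P A Q \<longleftrightarrow>
     projective_reconstruction P A Q \<and> (\<forall>k. proj (Q k) \<in> chiral_domain A)"

definition signed_reconstruction ::
  "('m::finite \<Rightarrow> 'n::finite \<Rightarrow> real^2) \<Rightarrow> ('m \<Rightarrow> real^4^3) \<Rightarrow> ('n \<Rightarrow> real^4) \<Rightarrow> ('m \<Rightarrow> real) \<Rightarrow> bool" where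
  "signed_reconstruction P A Q \<sigma> \<longleftrightarrow>
     projective_reconstruction P A Q \<and>
     (\<forall>i. \<sigma> i \<in> {-1, 1} \<and> (\<forall>k. sgn (principal_ray (A i) \<bullet> Q k) = \<sigma> i))"

section \<open>Cones\<close>

definition cone_of :: "(real^4) set \<Rightarrow> (real^4) set" where
  "cone_of U = {\<Sum>u\<in>U. a u *\<^sub>R u | a. \<forall>u\<in>U. 0 \<le> (a u :: real)}"

text \<open>
  Pitfall: for the dual \<open>K\<^sup>*\<close> of the cone \<open>K\<close> spanned by the signed centers, the interior that
  matters is the topological one, \<open>{y. y \<bullet> x > 0 for all x \<in> K - {0}}\<close> when \<open>K\<close> is pointed.  It agrees
  with \<^const>\<open>rel_interior\<close> when \<open>K\<^sup>*\<close> is full-dimensional.  If \<open>K\<close> contains a line (for example when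
  three centers \<open>c\<^sub>1, c\<^sub>2 = (c\<^sub>1 + c\<^sub>3)/2, c\<^sub>3\<close> carry the signs \<open>+, -, +\<close>), every vector of \<open>K\<^sup>*\<close>,
  and so every vector of its relative interior, is orthogonal to some center; a projective
  transformation with such a last row turns that camera into one that is not finite.
\<close>

definition dual_cone :: "(real^4) set \<Rightarrow> (real^4) set" where
  "dual_cone K = {y. \<forall>x\<in>K. 0 \<le> y \<bullet> x}"

end

theory Submission
  imports Defs
begin

text \<open>
  Only the last row \<open>h\<close> of \<open>H\<close> and the sign of \<open>det H\<close> decide whether \<open>H\<close> produces a chiral
  reconstruction. The row \<open>h\<close> describes the plane that \<open>H\<close> sends to infinity. The transformed
  camera \<open>B\<^sub>i = A\<^sub>i H\<^sup>-\<^sup>1\<close> is finite iff its center avoids that plane, \<open>h \<bullet> c\<^sub>i \<noteq> 0\<close>, and the key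
  identity (\<open>principal_ray_transform\<close>) is
    \<open>det H * (n(B\<^sub>i) \<bullet> H q) = (h \<bullet> c\<^sub>i) * (n(A\<^sub>i) \<bullet> q)\<close>,
  while the last coordinate of \<open>H q\<close> is \<open>h \<bullet> q\<close>. The identity comes from evaluating the determinant of
  the \<open>4 \<times> 4\<close> matrix with the three rows of \<open>A\<^sub>i\<close> on top of \<open>h\<close>: it is \<open>det G\<^sub>i * (h \<bullet> c\<^sub>i)\<close>, and it is
  also \<open>det H\<close> times the determinant of the left block of \<open>B\<^sub>i\<close>.

  A point \<open>q\<close> has positive depth in every camera iff the numbers \<open>n\<^sub>i \<bullet> q\<close> all have the sign of the
  last coordinate \<open>q\<^sub>4 \<noteq> 0\<close>. Up to the sign of the representative, the chiral domain therefore lies in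
  \<open>q\<^sub>4 \<ge> 0, n\<^sub>i \<bullet> q \<ge> 0\<close> (\<open>chiral_domain_sign\<close>), and it contains every point with \<open>q\<^sub>4 \<ge> 0\<close> and
  \<open>n\<^sub>i \<bullet> q > 0\<close>, since such a point can be pushed off the plane at infinity (\<open>chiral_domain_of_pos\<close>).

  If \<open>H\<close> works, every \<open>H q\<^sub>k\<close> has a representative \<open>s\<^sub>k H q\<^sub>k\<close> in the closed cone. The reconstruction is
  signed, so the key identity gives \<open>s\<^sub>k * sgn (det H) * \<sigma>\<^sub>i * sgn (h \<bullet> c\<^sub>i) = 1\<close> for all \<open>i\<close> and
  \<open>k\<close>. Hence \<open>s\<^sub>k = s\<close> is independent of \<open>k\<close>, the vector \<open>s h\<close> is nonnegative on all \<open>q\<^sub>k\<close>, and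
  \<open>sgn (det H) * \<sigma>\<^sub>i * (s h \<bullet> c\<^sub>i) > 0\<close> for all \<open>i\<close>. Such strict inequalities describe the interior
  of the dual of the cone of the vectors \<open>\<plusminus> \<sigma>\<^sub>i c\<^sub>i\<close> (\<open>interior_dual_cone_of\<close>), the sign being that of
  \<open>det H\<close>. Conversely, a vector \<open>h\<close> of that kind is the last row of an invertible \<open>H\<close> whose determinant
  has the required sign, and the same identity makes all \<open>n(B\<^sub>i) \<bullet> H q\<^sub>k\<close> positive.
\<close>

section \<open>The determinant of a camera matrix completed by a fourth row\<close>

lemma det_4:
  "det (A::'a::comm_ring_1^4^4) =
     A$1$1 * A$2$2 * A$3$3 * A$4$4
     + A$1$1 * A$2$3 * A$3$4 * A$4$2
     + A$1$1 * A$2$4 * A$3$2 * A$4$3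
     + A$1$2 * A$2$1 * A$3$4 * A$4$3
     + A$1$2 * A$2$3 * A$3$1 * A$4$4
     + A$1$2 * A$2$4 * A$3$3 * A$4$1
     + A$1$3 * A$2$1 * A$3$2 * A$4$4
     + A$1$3 * A$2$2 * A$3$4 * A$4$1
     + A$1$3 * A$2$4 * A$3$1 * A$4$2
     + A$1$4 * A$2$1 * A$3$3 * A$4$2
     + A$1$4 * A$2$2 * A$3$1 * A$4$3
     + A$1$4 * A$2$3 * A$3$2 * A$4$1
     - A$1$1 * A$2$2 * A$3$4 * A$4$3
     - A$1$1 * A$2$3 * A$3$2 * A$4$4
     - A$1$1 * A$2$4 * A$3$3 * A$4$2
     - A$1$2 * A$2$1 * A$3$3 * A$4$4
     - A$1$2 * A$2$3 * A$3$4 * A$4$1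
     - A$1$2 * A$2$4 * A$3$1 * A$4$3
     - A$1$3 * A$2$1 * A$3$4 * A$4$2
     - A$1$3 * A$2$2 * A$3$1 * A$4$4
     - A$1$3 * A$2$4 * A$3$2 * A$4$1
     - A$1$4 * A$2$1 * A$3$2 * A$4$3
     - A$1$4 * A$2$2 * A$3$3 * A$4$1
     - A$1$4 * A$2$3 * A$3$1 * A$4$2"
proof -
  have f1234: "finite {2::4, 3, 4}" "1 \<notin> {2::4, 3, 4}"
    and f234: "finite {3::4, 4}" "2 \<notin> {3::4, 4}"
    and f34: "finite {4::4}" "3 \<notin> {4::4}"
    by auto
  show ?thesis
    unfolding det_def UNIV_4
    unfolding sum_over_permutations_insert[OF f1234]
    unfolding sum_over_permutations_insert[OF f234]
    unfolding sum_over_permutations_insert[OF f34]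
    unfolding permutes_sing
    by (simp add: sign_swap_id permutation_swap_id permutation_compose sign_compose sign_id swap_id_eq)
qed

definition stack :: "real^4^3 \<Rightarrow> real^4 \<Rightarrow> real^4^4" where
  "stack A h = vector [A $ 1, A $ 2, A $ 3, h]"

lemma stack_nth [simp]:
  "stack A h $ 1 = A $ 1" "stack A h $ 2 = A $ 2" "stack A h $ 3 = A $ 3" "stack A h $ 4 = h"
  by (simp_all add: stack_def vector_def)

lemma left_block_nth [simp]:
  "left_block A $ i $ 1 = A $ i $ 1" "left_block A $ i $ 2 = A $ i $ 2" "left_block A $ i $ 3 = A $ i $ 3"
  by (simp_all add: left_block_def)

lemma n_inf_inner: "n_inf \<bullet> q = q $ 4"
  by (simp add: n_inf_def inner_axis')

lemma stack_mult: "stack A h ** H = stack (A ** H) (h v* H)"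
  by (simp add: vec_eq_iff forall_4 matrix_matrix_mult_def vector_matrix_mult_def mult.commute)

text \<open>
  Both evaluations below are needed for the transformation law: for a transformed camera the
  completing row is \<open>n_inf\<close>, and pulling back by \<open>H\<close> turns it into the last row of \<open>H\<close>.
\<close>

lemma det_stack_n_inf: "det (stack A n_inf) = det (left_block A)"
  by (simp add: det_4 det_3 n_inf_def axis_def)

text \<open>
  The vector \<open>c\<close> expresses the fourth column of \<open>A\<close> through the other three, so adding that
  combination of columns clears the fourth column except for its last entry, which becomes \<open>h \<bullet> c\<close>.
\<close>

lemma det_stack_kernel:
  assumes "A *v c = 0" "c $ 4 = 1"
  shows "det (stack A h) = det (left_block A) * (h \<bullet> c)"
proof -
  have "A $ i $ 4 = - (A $ i $ 1 * c $ 1 + A $ i $ 2 * c $ 2 + A $ i $ 3 * c $ 3)" for i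
  proof -
    have "(A *v c) $ i = 0"
      using assms(1) by simp
    then show ?thesis
      using assms(2) by (simp add: matrix_vector_mult_def sum_4)
  qed
  then show ?thesis
    using assms(2) by (simp add: det_4 det_3 inner_vec_def sum_4) (simp add: algebra_simps)
qed

section \<open>The center of a camera spans its kernel\<close>

lemma invertible_matrix_inv:
  assumes "invertible H"
  shows "H ** matrix_inv H = mat 1" "matrix_inv H ** H = mat 1"
proof -
  have "\<exists>H'. H ** H' = mat 1 \<and> H' ** H = mat 1"
    using assms by (simp add: invertible_def)
  from someI_ex[OF this] show "H ** matrix_inv H = mat 1" "matrix_inv H ** H = mat 1"
    by (simp_all add: matrix_inv_def)
qed

lemma camera_mult_center:
  assumes "finite_camera A"
  shows "A *v center A = 0"
proof -
  define v where "v = matrix_inv (left_block A) *v column 4 A"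
  have "left_block A *v v = column 4 A"
    using assms invertible_matrix_inv(1)[of "left_block A"]
    by (simp add: v_def finite_camera_def invertible_det_nz matrix_vector_mul_assoc)
  then have "(left_block A *v v) $ i = A $ i $ 4" for i
    by (simp add: column_def)
  moreover have "(A *v center A) $ i = - (left_block A *v v) $ i + A $ i $ 4" for i
    unfolding center_def homog3_def v_def[symmetric]
    by (simp add: matrix_vector_mult_def sum_3 sum_4 vector_def)
  ultimately show ?thesis
    by (simp add: vec_eq_iff)
qed

lemma center_nth_4 [simp]: "center A $ 4 = 1"
  by (simp add: center_def homog3_def vector_def)

lemma center_nonzero [simp]: "center A \<noteq> 0"
  by (metis center_nth_4 zero_index zero_neq_one)

lemma camera_kernel:
  assumes A: "finite_camera A" and x: "A *v x = 0"
  shows "x = x $ 4 *\<^sub>R center A"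
proof -
  define z where "z = x - x $ 4 *\<^sub>R center A"
  define y :: "real^3" where "y = vector [z $ 1, z $ 2, z $ 3]"
  have z4: "z $ 4 = 0"
    by (simp add: z_def)
  have "A *v z = 0"
    using x camera_mult_center[OF A]
    by (simp add: z_def matrix_vector_mult_diff_distrib matrix_vector_mult_scaleR)
  then have "(A *v z) $ i = 0" for i
    by simp
  then have "left_block A *v y = 0"
    using z4 by (simp add: y_def vec_eq_iff matrix_vector_mult_def sum_3 sum_4)
  then have "y = 0"
    using A injD[OF inj_matrix_vector_mult, of "left_block A" y 0]
    by (simp add: finite_camera_def invertible_det_nz)
  then have "z = 0"
    using z4 by (simp add: y_def vec_eq_iff forall_3 forall_4)
  then show ?thesis
    by (simp add: z_def)
qed

section \<open>How cameras transform under projective transformations\<close>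

lemma principal_ray_inner: "principal_ray A \<bullet> q = det (left_block A) * (A *v q) $ 3"
  by (simp add: principal_ray_def row_def inner_vec_def matrix_vector_mult_def sum_distrib_left
      mult.assoc)

lemma matrix_vector_nth_4: "(H *v q) $ 4 = H $ 4 \<bullet> q" for H :: "real^4^4"
  by (simp add: matrix_vector_mult_def inner_vec_def)

lemma n_inf_vector_matrix: "n_inf v* H = H $ 4"
  by (simp add: vec_eq_iff vector_matrix_mult_def n_inf_def axis_def sum_4)

text \<open>
  The original camera is written \<open>B ** H\<close> and the transformed one \<open>B\<close>, which keeps the inverse of
  \<open>H\<close> out of the formulas. The identity also covers the case where \<open>B\<close> is not finite, and so it decides
  when \<open>B\<close> is finite.
\<close>

lemma det_left_block_transform:
  assumes "finite_camera (B ** H)"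
  shows "det H * det (left_block B) = (H $ 4 \<bullet> center (B ** H)) * det (left_block (B ** H))"
proof -
  have "det (left_block B) * det H = det (stack B n_inf ** H)"
    by (simp add: det_mul det_stack_n_inf)
  also have "\<dots> = det (stack (B ** H) (H $ 4))"
    by (simp add: stack_mult n_inf_vector_matrix)
  also have "\<dots> = det (left_block (B ** H)) * (H $ 4 \<bullet> center (B ** H))"
    by (simp add: det_stack_kernel camera_mult_center assms)
  finally show ?thesis
    by (simp add: mult.commute)
qed

text \<open>
  A principal ray tests a point by the third image coordinate scaled by the determinant of the left
  block. The image of a point is unchanged, so only the determinant contributes.
\<close>

lemma principal_ray_transform:
  assumes "finite_camera (B ** H)"
  shows "det H * (principal_ray B \<bullet> (H *v q)) =
    (H $ 4 \<bullet> center (B ** H)) * (principal_ray (B ** H) \<bullet> q)"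
  using det_left_block_transform[OF assms]
  by (simp add: principal_ray_inner matrix_vector_mul_assoc mult.assoc[symmetric])

lemma finite_camera_transform:
  assumes H: "invertible H" and A: "finite_camera (B ** H)"
  shows "finite_camera B \<longleftrightarrow> H $ 4 \<bullet> center (B ** H) \<noteq> 0"
proof -
  have "surj ((*v) (B ** H))"
    using A full_rank_surjective[of "B ** H"] by (simp add: finite_camera_def camera_def)
  then have "surj ((*v) B)"
    unfolding surj_def by (metis matrix_vector_mul_assoc)
  then have "camera B"
    using full_rank_surjective[of B] by (simp add: camera_def)
  then show ?thesis
    using A H det_left_block_transform[OF A]
    by (auto simp: finite_camera_def invertible_det_nz)
qed

text \<open>
  Once the new cameras are finite, their centers are automatically distinct: the new center is
  \<open>H c / (h \<bullet> c)\<close>, and the original centers are normalized to have last coordinate \<open>1\<close>, so that they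
  can only be proportional if they are equal.
\<close>

lemma finite_arrangement_transform:
  assumes H: "invertible H" and A: "finite_arrangement (\<lambda>i. B i ** H)"
  shows "finite_arrangement B \<longleftrightarrow> (\<forall>i. H $ 4 \<bullet> center (B i ** H) \<noteq> 0)"
proof -
  have fin: "finite_camera (B i ** H)" for i
    using A by (simp add: finite_arrangement_def)
  have "inj (\<lambda>i. center (B i))" if B: "\<And>i. finite_camera (B i)"
  proof (rule injI)
    fix i j assume eq: "center (B i) = center (B j)"
    have img: "H *v center (B l ** H) = (H $ 4 \<bullet> center (B l ** H)) *\<^sub>R center (B l)" for l
      using camera_kernel[OF B[of l], of "H *v center (B l ** H)"]
      by (simp add: matrix_vector_mul_assoc camera_mult_center fin matrix_vector_nth_4)
    let ?a = "H $ 4 \<bullet> center (B i ** H)" and ?b = "H $ 4 \<bullet> center (B j ** H)"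
    have "?b *\<^sub>R (H *v center (B i ** H)) = ?a *\<^sub>R (H *v center (B j ** H))"
      by (simp add: img eq)
    then have "H *v (?b *\<^sub>R center (B i ** H)) = H *v (?a *\<^sub>R center (B j ** H))"
      by (simp add: matrix_vector_mult_scaleR)
    then have *: "?b *\<^sub>R center (B i ** H) = ?a *\<^sub>R center (B j ** H)"
      using inj_matrix_vector_mult[OF H] by (blast dest: injD)
    then have "(?b *\<^sub>R center (B i ** H)) $ 4 = (?a *\<^sub>R center (B j ** H)) $ 4"
      by (rule arg_cong)
    then have "?b = ?a"
      by simp
    moreover have "?b \<noteq> 0"
      using B finite_camera_transform[OF H fin] by blast
    ultimately have "center (B i ** H) = center (B j ** H)"
      using * by simp
    then show "i = j"
      using A by (auto simp: finite_arrangement_def dest: injD)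
  qed
  then show ?thesis
    using finite_camera_transform[OF H fin] by (auto simp: finite_arrangement_def)
qed

lemma projective_reconstruction_transform:
  assumes H: "invertible H" and R: "projective_reconstruction P (\<lambda>i. B i ** H) Q"
  shows "projective_reconstruction P B (\<lambda>k. H *v Q k) \<longleftrightarrow>
    (\<forall>i. H $ 4 \<bullet> center (B i ** H) \<noteq> 0)"
proof -
  have "H *v Q k \<noteq> 0" for k
    using R injD[OF inj_matrix_vector_mult[OF H], of "Q k" 0]
    by (auto simp: projective_reconstruction_def)
  then show ?thesis
    using R finite_arrangement_transform[OF H, of B]
    by (auto simp: projective_reconstruction_def matrix_vector_mul_assoc)
qed

section \<open>The chiral domain in homogeneous coordinates\<close>

lemma open_proj_preimage:
  assumes "open U"
  shows "open {x. x \<noteq> 0 \<and> proj x \<in> U}"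
proof -
  have "openin (top_of_set (- {0})) {x. x \<noteq> 0 \<and> proj x \<in> U}"
    using assms by (simp add: open_proj3_def)
  then show ?thesis
    by (simp add: openin_open_eq open_Compl)
qed

text \<open>
  For sets of vectors closed under nonzero scaling, closures in projective space can be computed
  upstairs: the complement of the closure is again closed under scaling, so its image is open in the
  quotient topology.
\<close>

lemma proj_in_closure_iff:
  assumes x: "x \<noteq> 0" and S: "0 \<notin> S" "\<And>c q. c \<noteq> 0 \<Longrightarrow> q \<in> S \<Longrightarrow> c *\<^sub>R q \<in> S"
  shows "proj x \<in> closure (proj ` S) \<longleftrightarrow> x \<in> closure S"
proof
  assume L: "proj x \<in> closure (proj ` S)"
  show "x \<in> closure S"
  proof (rule ccontr)
    assume nx: "x \<notin> closure S"
    define N where "N = {y. y \<noteq> 0 \<and> y \<notin> closure S}"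
    have sat: "c *\<^sub>R y \<in> closure S" if "c \<noteq> 0" "y \<in> closure S" for c y
    proof -
      have "c *\<^sub>R y \<in> closure ((*\<^sub>R) c ` S)"
        using that closure_scaleR[of c S] by blast
      moreover have "(*\<^sub>R) c ` S \<subseteq> S"
        using S(2) that by auto
      ultimately show ?thesis
        using closure_mono by blast
    qed
    \<comment> \<open>\<open>N\<close> is a union of punctured lines, so that its image separates \<open>proj x\<close> from the image of \<open>S\<close>.\<close>
    have "{y \<in> - {0}. proj y \<in> proj ` N} = N"
    proof (intro equalityI subsetI)
      fix y assume y: "y \<in> {y \<in> - {0}. proj y \<in> proj ` N}"
      then obtain z where z: "z \<noteq> 0" "z \<notin> closure S" "proj z = proj y"
        by (auto simp: N_def)
      then obtain c where "c \<noteq> 0" "z = c *\<^sub>R y"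
        using y proj_eq_iff by blast
      then show "y \<in> N"
        using sat y z(2) by (auto simp: N_def)
    qed (auto simp: N_def)
    moreover have "N = - {0} \<inter> - closure S"
      by (auto simp: N_def)
    ultimately have "open (proj ` N)"
      unfolding open_proj3_def by (metis closed_closure open_Compl openin_open_Int)
    moreover have "proj x \<in> proj ` N"
      using x nx by (simp add: N_def)
    ultimately obtain q where q: "q \<in> S" "proj q \<in> proj ` N"
      using L closure_iff_nhds_not_empty[of "proj x" "proj ` S"] by blast
    then obtain y where y: "y \<noteq> 0" "y \<notin> closure S" "proj q = proj y"
      by (auto simp: N_def)
    moreover have "q \<noteq> 0"
      using q S by auto
    ultimately obtain c where "c \<noteq> 0" "y = c *\<^sub>R q"
      by (metis proj_eq_iff)
    then show False
      using S(2) q(1) y(2) closure_subset by blast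
  qed
next
  assume R: "x \<in> closure S"
  show "proj x \<in> closure (proj ` S)"
    unfolding closure_iff_nhds_not_empty
  proof (intro allI impI)
    fix T V assume "V \<subseteq> T" "proj x \<in> V" "open V"
    then have "S \<inter> {y. y \<noteq> 0 \<and> proj y \<in> V} \<noteq> {}"
      using R x open_proj_preimage[of V] unfolding closure_iff_nhds_not_empty by blast
    then show "proj ` S \<inter> T \<noteq> {}"
      using \<open>V \<subseteq> T\<close> by blast
  qed
qed

lemma depth_pos_iff:
  assumes "finite_camera A"
  shows "depth q A > 0 \<longleftrightarrow> (principal_ray A \<bullet> q) * q $ 4 > 0"
proof -
  have "row 3 (left_block A) \<noteq> 0" "det (left_block A) \<noteq> 0"
    using assms det_zero_row(2)[of 3 "left_block A"] by (auto simp: finite_camera_def)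
  then have "1 / (\<bar>det (left_block A)\<bar> * norm (row 3 (left_block A))) > 0"
    by simp
  then have "depth q A > 0 \<longleftrightarrow> (principal_ray A \<bullet> q) / q $ 4 > 0"
    unfolding depth_def n_inf_inner by (metis mult_pos_pos zero_less_mult_pos)
  then show ?thesis
    by (simp add: zero_less_divide_iff zero_less_mult_iff)
qed

text \<open>
  The conditions \<open>q \<noteq> 0\<close> and \<open>q $ 4 \<noteq> 0\<close> disappear on the right because an arrangement has at least one
  camera, and the product for that camera already forces both.
\<close>

lemma proj_in_chiral_domain_iff:
  fixes A :: "'m::finite \<Rightarrow> real^4^3"
  assumes "finite_arrangement A" and "x \<noteq> 0"
  shows "proj x \<in> chiral_domain A \<longleftrightarrow>
    x \<in> closure {q. \<forall>i. (principal_ray (A i) \<bullet> q) * q $ 4 > 0}"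
proof -
  let ?S = "{q. \<forall>i. (principal_ray (A i) \<bullet> q) * q $ 4 > 0}"
  have S: "{q. q \<noteq> 0 \<and> q $ 4 \<noteq> 0 \<and> (\<forall>i. depth q (A i) > 0)} = ?S"
    using assms(1) by (force simp: finite_arrangement_def depth_pos_iff)
  have scale: "c *\<^sub>R q \<in> ?S" if "c \<noteq> 0" "q \<in> ?S" for c q
  proof -
    have "c * c > 0"
      using that(1) by (auto simp: zero_less_mult_iff)
    then have "(c * c) * ((principal_ray (A i) \<bullet> q) * q $ 4) > 0" for i
      using that(2) by (metis (mono_tags, lifting) mem_Collect_eq mult_pos_pos)
    then show ?thesis
      by (simp add: mult.assoc mult.left_commute)
  qed
  have "0 \<notin> ?S"
    by simp
  from proj_in_closure_iff[OF assms(2) this scale] show ?thesis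
    unfolding chiral_domain_def S .
qed

text \<open>
  The set of points with positive depths is the union of two opposite cones, each of them contained
  in a closed one; a finite union of closed sets contains the closure.
\<close>

lemma chiral_domain_sign:
  fixes A :: "'m::finite \<Rightarrow> real^4^3"
  assumes "finite_arrangement A" "x \<noteq> 0" "proj x \<in> chiral_domain A"
  obtains s :: real where "s \<in> {-1, 1}" "0 \<le> s * x $ 4" "\<And>i. 0 \<le> s * (principal_ray (A i) \<bullet> x)"
proof -
  define F where
    "F s = {q :: real^4. 0 \<le> s * q $ 4 \<and> (\<forall>i. 0 \<le> s * (principal_ray (A i) \<bullet> q))}" for s :: real
  have "F s = {q. 0 \<le> s * q $ 4} \<inter> (\<Inter>i. {q. 0 \<le> s * (principal_ray (A i) \<bullet> q)})" for s
    by (auto simp: F_def)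
  moreover have "closed {q :: real^4. 0 \<le> s * q $ 4}" for s
    by (intro closed_Collect_le continuous_intros)
  moreover have "closed {q. 0 \<le> s * (principal_ray (A i) \<bullet> q)}" for s i
    by (intro closed_Collect_le continuous_intros)
  ultimately have "closed (F s)" for s
    by (simp add: closed_Int closed_INT)
  moreover have "{q. \<forall>i. (principal_ray (A i) \<bullet> q) * q $ 4 > 0} \<subseteq> F 1 \<union> F (-1)"
  proof
    fix q assume q: "q \<in> {q. \<forall>i. (principal_ray (A i) \<bullet> q) * q $ 4 > 0}"
    show "q \<in> F 1 \<union> F (-1)"
    proof (cases "q $ 4 \<ge> 0")
      case True
      then have "0 \<le> principal_ray (A i) \<bullet> q" for i
        using q by (simp add: zero_less_mult_iff) (meson less_imp_le not_less)
      then show ?thesis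
        using True by (simp add: F_def)
    next
      case False
      then have "principal_ray (A i) \<bullet> q \<le> 0" for i
        using q by (simp add: zero_less_mult_iff) (meson less_imp_le not_less)
      then show ?thesis
        using False by (simp add: F_def)
    qed
  qed
  ultimately have "closure {q. \<forall>i. (principal_ray (A i) \<bullet> q) * q $ 4 > 0} \<subseteq> F 1 \<union> F (-1)"
    by (intro closure_minimal closed_Un)
  moreover have "x \<in> closure {q. \<forall>i. (principal_ray (A i) \<bullet> q) * q $ 4 > 0}"
    using assms(3) by (simp only: proj_in_chiral_domain_iff[OF assms(1,2)])
  ultimately consider "x \<in> F 1" | "x \<in> F (-1)"
    by blast
  then show ?thesis
  proof cases
    case 1
    then show ?thesis
      by (intro that[of 1]) (simp_all add: F_def)
  next
    case 2
    then show ?thesis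
      by (intro that[of "-1"]) (simp_all add: F_def)
  qed
qed

text \<open>
  The strict inequalities are open conditions, so moving the point slightly into \<open>q $ 4 > 0\<close> keeps
  them and makes all depths positive. The point itself may lie in the plane at infinity.
\<close>

lemma chiral_domain_of_pos:
  fixes A :: "'m::finite \<Rightarrow> real^4^3"
  assumes "finite_arrangement A" "x \<noteq> 0" "0 \<le> x $ 4" "\<And>i. 0 < principal_ray (A i) \<bullet> x"
  shows "proj x \<in> chiral_domain A"
proof -
  let ?U = "{q. \<forall>i. 0 < principal_ray (A i) \<bullet> q}" and ?V = "{q :: real^4. q $ 4 > 0}"
  have "?U = (\<Inter>i. {q. 0 < principal_ray (A i) \<bullet> q})"
    by auto
  then have "open ?U"
    by (simp add: open_INT open_halfspace_gt)
  moreover have "x \<in> closure ?V"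
    using assms(3) by (simp add: closure_halfspace_component_gt)
  ultimately have "x \<in> closure (?U \<inter> ?V)"
    using open_Int_closure_subset[of ?U ?V] assms(4) by blast
  moreover have "?U \<inter> ?V \<subseteq> {q. \<forall>i. (principal_ray (A i) \<bullet> q) * q $ 4 > 0}"
    by auto
  ultimately show ?thesis
    unfolding proj_in_chiral_domain_iff[OF assms(1,2)] using closure_mono by blast
qed

section \<open>Dual cones of finite sets\<close>

lemma dual_cone_cone_of:
  assumes "finite U"
  shows "dual_cone (cone_of U) = {y. \<forall>u\<in>U. 0 \<le> y \<bullet> u}"
proof (intro equalityI subsetI CollectI ballI)
  fix y u assume y: "y \<in> dual_cone (cone_of U)" and u: "u \<in> U"
  have "(\<Sum>v\<in>U. (if v = u then 1 else 0) *\<^sub>R v) \<in> cone_of U"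
    unfolding cone_of_def by fastforce
  moreover have "(\<Sum>v\<in>U. (if v = u then 1 else 0) *\<^sub>R v) = u"
    using assms u by (simp add: if_distrib[of "\<lambda>c. c *\<^sub>R _"] cong: if_cong)
  ultimately show "0 \<le> y \<bullet> u"
    using y by (auto simp: dual_cone_def)
next
  fix y assume "y \<in> {y. \<forall>u\<in>U. 0 \<le> y \<bullet> u}"
  then show "y \<in> dual_cone (cone_of U)"
    by (auto simp: dual_cone_def cone_of_def inner_sum_right intro!: sum_nonneg)
qed

text \<open>
  Around an interior point the functional \<open>y \<mapsto> y \<bullet> u\<close> with \<open>u \<noteq> 0\<close> takes smaller values as
  well, so the value at the point cannot be \<open>0\<close>. The zero vector must be excluded, because its
  inequality is never strict.
\<close>

lemma interior_dual_cone_of: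
  assumes "finite U" "0 \<notin> U"
  shows "interior (dual_cone (cone_of U)) = {y. \<forall>u\<in>U. 0 < y \<bullet> u}"
proof (rule interior_unique)
  show "{y. \<forall>u\<in>U. 0 < y \<bullet> u} \<subseteq> dual_cone (cone_of U)"
    by (auto simp: dual_cone_cone_of[OF assms(1)] less_imp_le)
  have "{y. \<forall>u\<in>U. 0 < y \<bullet> u} = (\<Inter>u\<in>U. {y. u \<bullet> y > 0})"
    by (auto simp: inner_commute)
  then show "open {y. \<forall>u\<in>U. 0 < y \<bullet> u}"
    using assms(1) by (simp add: open_INT open_halfspace_gt)
next
  fix T assume T: "T \<subseteq> dual_cone (cone_of U)" "open T"
  show "T \<subseteq> {y. \<forall>u\<in>U. 0 < y \<bullet> u}"
  proof (intro subsetI CollectI ballI)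
    fix y u assume y: "y \<in> T" and u: "u \<in> U"
    have "T \<subseteq> {y. u \<bullet> y \<ge> 0}"
      using T(1) u by (auto simp: dual_cone_cone_of[OF assms(1)] inner_commute)
    then have "T \<subseteq> interior {y. u \<bullet> y \<ge> 0}"
      using T(2) by (simp add: interior_maximal)
    moreover have "u \<noteq> 0"
      using assms(2) u by auto
    ultimately show "0 < y \<bullet> u"
      using y interior_halfspace_ge[of u 0] by (auto simp: inner_commute[of y])
  qed
qed

section \<open>Chirality and the last row of the transformation\<close>

text \<open>
  A rotation takes the last basis vector to the direction of \<open>h\<close>. Its transpose has that direction as
  last row; rescaling this row gives \<open>h\<close>, and the first row is free to carry the sign of the determinant.
\<close>

lemma matrix_with_last_row:
  fixes h :: "real^4"
  assumes "h \<noteq> 0" and "\<epsilon> \<in> {-1, 1 :: real}"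
  obtains H :: "real^4^4" where "invertible H" "H $ 4 = h" "0 < \<epsilon> * det H"
proof -
  have "norm ((1 / norm h) *\<^sub>R h) = 1"
    using assms(1) by simp
  then obtain R where R: "rotation_matrix R" "R *v axis 4 1 = (1 / norm h) *\<^sub>R h"
    using rotation_matrix_exists_basis[of "(1 / norm h) *\<^sub>R h" 4] by auto
  define M where "M = transpose R"
  have M4: "M $ 4 = (1 / norm h) *\<^sub>R h"
    using R(2) by (simp add: M_def transpose_def vec_eq_iff matrix_vector_mult_def axis_def if_distrib cong: if_cong)
  have detM: "det M = 1"
    using R(1) by (simp add: M_def rotation_matrix_def)
  define H where
    "H = (\<chi> i. if i = 1 then \<epsilon> *s M $ i else if i = 4 then norm h *s M $ i else M $ i)"
  have "det H = \<epsilon> * (norm h * det M)"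
    unfolding H_def det_row_mul
    by (simp add: det_4) (simp add: algebra_simps)
  moreover have "\<epsilon> * (\<epsilon> * norm h) > 0"
    using assms by auto
  ultimately have "0 < \<epsilon> * det H"
    using detM by simp
  moreover have "H $ 4 = h"
    using assms(1) M4 by (simp add: H_def vec_eq_iff)
  moreover have "invertible H"
    using \<open>0 < \<epsilon> * det H\<close> by (auto simp: invertible_det_nz)
  ultimately show ?thesis
    using that by blast
qed

text \<open>
  The sign \<open>s\<close> chooses representatives \<open>s H q\<^sub>k\<close> in the closed cone over the chiral domain. A priori it
  depends on \<open>k\<close>; the point of the lemma is that any single camera determines it from data that do
  not involve \<open>k\<close>.
\<close>

lemma chiral_reconstruction_imp_signs:
  fixes P :: "'m::finite \<Rightarrow> 'n::finite \<Rightarrow> real^2"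
  assumes H: "invertible H" and R: "signed_reconstruction P (\<lambda>i. B i ** H) Q \<sigma>"
    and chiral: "chiral_reconstruction P B (\<lambda>k. H *v Q k)"
  obtains s :: real where "s \<in> {-1, 1}" "\<And>k. 0 \<le> s * (H $ 4 \<bullet> Q k)"
    "\<And>i. s * sgn (det H) * \<sigma> i * sgn (H $ 4 \<bullet> center (B i ** H)) = 1"
proof -
  let ?\<delta> = "\<lambda>i. H $ 4 \<bullet> center (B i ** H)"
  have fin: "finite_camera (B i ** H)" for i
    using R by (simp add: signed_reconstruction_def projective_reconstruction_def finite_arrangement_def)
  have proj_rec: "projective_reconstruction P B (\<lambda>k. H *v Q k)"
    using chiral by (simp add: chiral_reconstruction_def)
  have \<delta>: "?\<delta> i \<noteq> 0" for i
    using projective_reconstruction_transform[OF H] R proj_rec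
    by (auto simp: signed_reconstruction_def)
  have det: "det H \<noteq> 0"
    using H by (simp add: invertible_det_nz)
  have \<sigma>: "\<sigma> i \<in> {-1, 1}" "sgn (principal_ray (B i ** H) \<bullet> Q k) = \<sigma> i" for i k
    using R by (simp_all add: signed_reconstruction_def)
  have "\<exists>s \<in> {-1, 1 :: real}. 0 \<le> s * (H $ 4 \<bullet> Q k) \<and> (\<forall>i. s * sgn (det H) * \<sigma> i * sgn (?\<delta> i) = 1)"
    for k
  proof -
    have "finite_arrangement B" "H *v Q k \<noteq> 0" "proj (H *v Q k) \<in> chiral_domain B"
      using chiral by (simp_all add: chiral_reconstruction_def projective_reconstruction_def)
    then obtain s :: real where s: "s \<in> {-1, 1}" "0 \<le> s * (H *v Q k) $ 4"
      "\<And>i. 0 \<le> s * (principal_ray (B i) \<bullet> (H *v Q k))"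
      using chiral_domain_sign by blast
    have "s * sgn (det H) * \<sigma> i * sgn (?\<delta> i) = 1" for i
    proof -
      let ?n = "principal_ray (B i) \<bullet> (H *v Q k)"
      have eq: "sgn (det H) * sgn ?n = sgn (?\<delta> i) * \<sigma> i"
        using arg_cong[OF principal_ray_transform[OF fin[of i], of "Q k"], of sgn] \<sigma>(2)[of i k]
        by (simp add: sgn_mult)
      have "sgn (?\<delta> i) * \<sigma> i \<noteq> 0"
        using \<delta>[of i] \<sigma>(1)[of i] by (auto simp: sgn_zero_iff)
      with eq have "?n \<noteq> 0"
        by auto
      then have "sgn ?n = s"
        using s(1) s(3)[of i] by (auto simp: sgn_if)
      with eq have "s * sgn (det H) * \<sigma> i * sgn (?\<delta> i) = (s * sgn (det H)) * (s * sgn (det H))"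
        by (simp add: mult_ac)
      also have "\<dots> = 1"
        using s(1) det by (auto simp: sgn_if)
      finally show ?thesis .
    qed
    then show ?thesis
      using s by (auto simp: matrix_vector_nth_4)
  qed
  then obtain s where s: "\<And>k. s k \<in> {-1, 1 :: real}" "\<And>k. 0 \<le> s k * (H $ 4 \<bullet> Q k)"
    "\<And>k i. s k * sgn (det H) * \<sigma> i * sgn (?\<delta> i) = 1"
    by metis
  have same: "s k = s l" for k l
  proof -
    fix i :: 'm
    let ?t = "sgn (det H) * \<sigma> i * sgn (?\<delta> i)"
    have "s k * ?t = s l * ?t" "?t \<noteq> 0"
      using s(3)[of k i] s(3)[of l i] by (auto simp: mult.assoc)
    then show ?thesis
      by simp
  qed
  show ?thesis
  proof (rule that)
    fix k
    show "0 \<le> s undefined * (H $ 4 \<bullet> Q k)"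
      using s(2)[of k] by (simp only: same[of undefined k])
  qed (rule s)+
qed

text \<open>
  The principal ray of the transformed camera pairs with \<open>H q\<^sub>k\<close> to a positive number, since
  \<open>det H\<close>, \<open>h \<bullet> c\<^sub>i\<close> and \<open>n\<^sub>i \<bullet> q\<^sub>k\<close> have signs with product \<open>1\<close>. The last coordinate \<open>h \<bullet> q\<^sub>k\<close> of \<open>H q\<^sub>k\<close> is only
  nonnegative, which is enough in the closure.
\<close>

lemma chiral_reconstruction_of_signs:
  fixes P :: "'m::finite \<Rightarrow> 'n::finite \<Rightarrow> real^2"
  assumes H: "invertible H" and R: "signed_reconstruction P (\<lambda>i. B i ** H) Q \<sigma>"
    and Q: "\<And>k. 0 \<le> H $ 4 \<bullet> Q k"
    and C: "\<And>i. 0 < det H * (\<sigma> i * (H $ 4 \<bullet> center (B i ** H)))"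
  shows "chiral_reconstruction P B (\<lambda>k. H *v Q k)"
proof -
  have "H $ 4 \<bullet> center (B i ** H) \<noteq> 0" for i
    using C[of i] by auto
  then have proj_rec: "projective_reconstruction P B (\<lambda>k. H *v Q k)"
    using projective_reconstruction_transform[OF H, of P B Q] R
    by (simp add: signed_reconstruction_def)
  have pos: "0 < principal_ray (B i) \<bullet> (H *v Q k)" for i k
  proof -
    let ?n = "principal_ray (B i) \<bullet> (H *v Q k)" and ?\<delta> = "H $ 4 \<bullet> center (B i ** H)"
      and ?m = "principal_ray (B i ** H) \<bullet> Q k"
    have fin: "finite_camera (B i ** H)"
      using R by (simp add: signed_reconstruction_def projective_reconstruction_def finite_arrangement_def)
    have "\<sigma> i = - 1 \<or> \<sigma> i = 1" "sgn ?m = \<sigma> i"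
      using R by (auto simp: signed_reconstruction_def)
    then have \<sigma>: "\<sigma> i * \<sigma> i = 1" "0 < \<sigma> i * ?m"
      by (auto simp: sgn_1_pos sgn_1_neg)
    have "(det H)\<^sup>2 * ?n = det H * (det H * ?n)"
      by (simp add: power2_eq_square)
    also have "\<dots> = det H * (?\<delta> * ?m)"
      by (simp only: principal_ray_transform[OF fin])
    also have "\<dots> = (\<sigma> i * \<sigma> i) * (det H * (?\<delta> * ?m))"
      by (simp add: \<sigma>(1))
    also have "\<dots> = (det H * (\<sigma> i * ?\<delta>)) * (\<sigma> i * ?m)"
      by (simp only: mult_ac)
    also have "\<dots> > 0"
      using C \<sigma>(2) by (rule mult_pos_pos)
    finally show ?thesis
      by (simp add: zero_less_mult_iff)
  qed
  show ?thesis
    using proj_rec Q pos chiral_domain_of_pos[of B]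
    by (simp add: chiral_reconstruction_def projective_reconstruction_def matrix_vector_nth_4)
qed

theorem theorem7:
  fixes P :: "'m::finite \<Rightarrow> 'n::finite \<Rightarrow> real^2"
    and A :: "'m \<Rightarrow> real^4^3"
    and Q :: "'n \<Rightarrow> real^4"
    and \<sigma> :: "'m \<Rightarrow> real"
  assumes "signed_reconstruction P A Q \<sigma>"
  shows "(\<exists>H :: real^4^4. invertible H \<and>
            chiral_reconstruction P (\<lambda>i. A i ** matrix_inv H) (\<lambda>k. H *v Q k))
         \<longleftrightarrow>
         (\<exists>h. h \<noteq> 0 \<and>
            h \<in> dual_cone (cone_of (range Q)) \<inter>
                (interior (dual_cone (cone_of (range (\<lambda>i. \<sigma> i *\<^sub>R center (A i))))) \<union>
                 interior (dual_cone (cone_of (range (\<lambda>i. - \<sigma> i *\<^sub>R center (A i)))))))"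
    (is "?chiral \<longleftrightarrow> ?cone")
proof -
  have \<sigma>: "\<sigma> i \<in> {-1, 1}" for i
    using assms by (simp add: signed_reconstruction_def)
  have int: "interior (dual_cone (cone_of (range (\<lambda>i. (\<epsilon> * \<sigma> i) *\<^sub>R center (A i))))) =
      {h. \<forall>i. 0 < \<epsilon> * (\<sigma> i * (h \<bullet> center (A i)))}" if "\<epsilon> \<in> {-1, 1}" for \<epsilon> :: real
  proof -
    have "\<epsilon> * \<sigma> i \<noteq> 0" for i
      using that \<sigma>[of i] by auto
    then have "0 \<notin> range (\<lambda>i. (\<epsilon> * \<sigma> i) *\<^sub>R center (A i))"
      by auto
    then show ?thesis
      by (simp add: interior_dual_cone_of mult.assoc)
  qed
  \<comment> \<open>The sign \<open>\<epsilon>\<close> selects one of the two cones of signed centers; it will be the sign of \<open>det H\<close>.\<close>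
  have cone_iff: "?cone \<longleftrightarrow> (\<exists>h. \<exists>\<epsilon>\<in>{-1, 1}. h \<noteq> 0 \<and> (\<forall>k. 0 \<le> h \<bullet> Q k) \<and>
      (\<forall>i. 0 < \<epsilon> * (\<sigma> i * (h \<bullet> center (A i)))))"
    using int[of 1] int[of "-1"] by (auto simp: dual_cone_cone_of)
  have cancel: "A i ** matrix_inv H ** H = A i" if "invertible H" for i and H :: "real^4^4"
    using that by (simp add: matrix_mul_assoc[symmetric] invertible_matrix_inv)
  show ?thesis
    unfolding cone_iff
  proof (intro iffI)
    assume ?chiral
    then obtain H :: "real^4^4" where H: "invertible H"
      and chiral: "chiral_reconstruction P (\<lambda>i. A i ** matrix_inv H) (\<lambda>k. H *v Q k)"
      by blast
    obtain s :: real where s: "s \<in> {-1, 1}" "\<And>k. 0 \<le> s * (H $ 4 \<bullet> Q k)"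
      "\<And>i. s * sgn (det H) * \<sigma> i * sgn (H $ 4 \<bullet> center (A i)) = 1"
      using chiral_reconstruction_imp_signs[OF H _ chiral, of \<sigma>] assms by (auto simp: cancel[OF H])
    \<comment> \<open>Scaling the last row by \<open>s\<close> makes it nonnegative on the points; the cone that then contains it is
      determined by the sign of the determinant.\<close>
    let ?h = "s *\<^sub>R H $ 4" and ?\<epsilon> = "sgn (det H)"
    have "?\<epsilon> \<in> {-1, 1}"
      using H by (simp add: invertible_det_nz sgn_if)
    moreover have "?h \<noteq> 0"
      using s(1) s(3) by force
    moreover have "0 < ?\<epsilon> * (\<sigma> i * (?h \<bullet> center (A i)))" for i
    proof -
      have "sgn (?\<epsilon> * (\<sigma> i * (?h \<bullet> center (A i)))) = 1"
        using s(1) s(3)[of i] \<sigma>[of i] by (auto simp: sgn_mult)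
      then show ?thesis
        by (simp add: sgn_1_pos)
    qed
    ultimately show "\<exists>h. \<exists>\<epsilon>\<in>{-1, 1}. h \<noteq> 0 \<and> (\<forall>k. 0 \<le> h \<bullet> Q k) \<and>
        (\<forall>i. 0 < \<epsilon> * (\<sigma> i * (h \<bullet> center (A i))))"
      using s(2) by (metis inner_scaleR_left)
  next
    assume "\<exists>h. \<exists>\<epsilon>\<in>{-1, 1}. h \<noteq> 0 \<and> (\<forall>k. 0 \<le> h \<bullet> Q k) \<and>
        (\<forall>i. 0 < \<epsilon> * (\<sigma> i * (h \<bullet> center (A i))))"
    then obtain h and \<epsilon> :: real where h: "\<epsilon> \<in> {-1, 1}" "h \<noteq> 0" "\<And>k. 0 \<le> h \<bullet> Q k"
      "\<And>i. 0 < \<epsilon> * (\<sigma> i * (h \<bullet> center (A i)))"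
      by blast
    then obtain H :: "real^4^4" where H: "invertible H" "H $ 4 = h" "0 < \<epsilon> * det H"
      using matrix_with_last_row by blast
    have "0 < det H * (\<sigma> i * (h \<bullet> center (A i)))" for i
      using h(1) h(4)[of i] H(3) by (auto simp: zero_less_mult_iff)
    then have "chiral_reconstruction P (\<lambda>i. A i ** matrix_inv H) (\<lambda>k. H *v Q k)"
      using assms h(3) H by (intro chiral_reconstruction_of_signs[where \<sigma> = \<sigma>]) (simp_all add: cancel)
    then show ?chiral
      using H(1) by blast
  qed
qed

end
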